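(* Fix $x_0\in\mathbb{R}^n$, $X_0=x_0x_0^t$, and matrices $A_1,\dots,A_m\in\mathcal{S}^n$, and let $\mathcal{A}:\mathcal{S}^n\to\mathbb{R}^m$ be given by $\mathcal{A}(X)_i=\langle X,A_i\rangle$. If $\mathcal{A}$ does not satisfy the completeness condition at $X_0$, then there exists a convex continuous function $f:\mathcal{S}^n\to\mathbb{R}$ such that, with $b=\mathcal{A}(X_0)$, $X_0$ is a minimizer of $$\min f(X)\ \text{ subject to }\ X\succeq 0,\ \mathcal{A}(X)=b,$$ and no dual certificate exists at $X_0$ for this problem.
   Context: $\mathcal{S}^n$ is the space of real symmetric $n\times n$ matrices with inner product $\langle X,Y\rangle=\operatorname{tr}(Y^tX)$; $\perp$ denotes orthogonality for this inner product. $X\succeq 0$ (resp. $X\preceq 0$) means $X$ is positive (resp. negative) semidefinite. The adjoint of $\mathcal{A}$ is $\mathcal{A}^*\lambda=\sum_{i=1}^m\lambda_iA_i$. For $x,y\in\mathbb{R}^n$, $x\otimes y:=xy^t+yx^t$. $\partial f$ denotes the convex subdifferential with respect to $\langle\cdot,\cdot\rangle$ on $\mathcal{S}^n$. Let $S=\{\mathcal{A}^*\lambda+Q : \lambda\in\mathbb{R}^m,\ Q\in\mathcal{S}^n,\ Q\preceq 0,\ Q\perp X_0\}$. The completeness condition at $X_0=x_0x_0^t$ is: whenever $A=\mathcal{A}^*\lambda$ for some $\lambda\in\mathbb{R}^m$ with $A\succeq 0$ and $A\perp x_0x_0^t$, then $y\otimes q\in S$ for all $y\in\mathbb{R}^n$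 and all $q\in\operatorname{range}(A)$. A dual certificate at $X_0$ is a pair $(\lambda,Q)\in\mathbb{R}^m\times\mathcal{S}^n$ such that $\mathcal{A}^*\lambda+Q\in-\partial f(X_0)$, $Q\preceq 0$, and $Q\perp X_0$. *)

theory Defs
  imports "HOL-Analysis.Analysis"
begin

text \<open>
  The space of real symmetric matrices is the subspace \<open>sym_mats\<close> of \<open>real^'n^'n\<close>. Its inner
  product is the library's componentwise one, which is the trace inner product:
\<close>

lemma inner_matrix_eq_trace:
  fixes X Y :: "real^'n^'n"
  shows "X \<bullet> Y = trace (transpose Y ** X)"
proof -
  have "X \<bullet> Y = (\<Sum>k\<in>UNIV. \<Sum>i\<in>UNIV. X$k$i * Y$k$i)"
    by (simp add: inner_vec_def)
  also have "\<dots> = (\<Sum>i\<in>UNIV. \<Sum>k\<in>UNIV. X$k$i * Y$k$i)"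
    by (rule sum.swap)
  also have "\<dots> = trace (transpose Y ** X)"
    by (simp add: trace_def matrix_matrix_mult_def transpose_def mult.commute)
  finally show ?thesis .
qed

definition sym_mats :: "(real^'n^'n) set" where
  "sym_mats = {X. transpose X = X}"

definition psd :: "real^'n^'n \<Rightarrow> bool" where
  "psd X \<longleftrightarrow> X \<in> sym_mats \<and> (\<forall>v. 0 \<le> v \<bullet> (X *v v))"

definition nsd :: "real^'n^'n \<Rightarrow> bool" where
  "nsd X \<longleftrightarrow> X \<in> sym_mats \<and> (\<forall>v. v \<bullet> (X *v v) \<le> 0)"

definition outer :: "real^'n \<Rightarrow> real^'n \<Rightarrow> real^'n^'n" where
  "outer x y = (\<chi> i j. x$i * y$j)"

text \<open>The symmetrised tensor product carries no factor \<open>1/2\<close>.\<close>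

definition sym_tensor :: "real^'n \<Rightarrow> real^'n \<Rightarrow> real^'n^'n" where
  "sym_tensor x y = outer x y + outer y x"

definition meas :: "('m::finite \<Rightarrow> real^'n^'n) \<Rightarrow> real^'n^'n \<Rightarrow> real^'m" where
  "meas A X = (\<chi> i. X \<bullet> A i)"

definition meas_adj :: "('m::finite \<Rightarrow> real^'n^'n) \<Rightarrow> real^'m \<Rightarrow> real^'n^'n" where
  "meas_adj A l = (\<Sum>i\<in>UNIV. l$i *\<^sub>R A i)"

definition S_set :: "('m::finite \<Rightarrow> real^'n^'n) \<Rightarrow> real^'n^'n \<Rightarrow> (real^'n^'n) set" where
  "S_set A X0 = {meas_adj A l + Q | l Q. nsd Q \<and> orthogonal Q X0}"

definition completeness :: "('m::finite \<Rightarrow> real^'n^'n) \<Rightarrow> real^'n \<Rightarrow> bool" where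
  "completeness A x0 \<longleftrightarrow>
     (\<forall>B. (\<exists>l. B = meas_adj A l) \<and> psd B \<and> orthogonal B (outer x0 x0) \<longrightarrow>
       (\<forall>y. \<forall>q\<in>range ((*v) B). sym_tensor y q \<in> S_set A (outer x0 x0)))"

text \<open>
  A function on symmetric matrices is represented by a function on all matrices of which only
  the values on \<open>sym_mats\<close> matter; in particular, subgradients are symmetric and are tested
  against symmetric matrices only.
\<close>

definition subdifferential :: "(real^'n^'n \<Rightarrow> real) \<Rightarrow> real^'n^'n \<Rightarrow> (real^'n^'n) set" where
  "subdifferential f X = {G \<in> sym_mats. \<forall>Y\<in>sym_mats. f X + G \<bullet> (Y - X) \<le> f Y}"

definition dual_certificate ::
  "('m::finite \<Rightarrow> real^'n^'n) \<Rightarrow> (real^'n^'n \<Rightarrow> real) \<Rightarrow> real^'n^'n \<Rightarrow> real^'m \<Rightarrow> real^'n^'n \<Rightarrow> bool" where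
  "dual_certificate A f X0 l Q \<longleftrightarrow>
     meas_adj A l + Q \<in> uminus ` subdifferential f X0 \<and> nsd Q \<and> orthogonal Q X0"

definition feasible :: "('m::finite \<Rightarrow> real^'n^'n) \<Rightarrow> real^'m \<Rightarrow> real^'n^'n \<Rightarrow> bool" where
  "feasible A b X \<longleftrightarrow> psd X \<and> meas A X = b"

end

(* If completeness fails for A = A*(l) with T = y (x) q outside S and q in range A, take the
   linear objective f X = - <T, X>.  Every feasible X is positive semidefinite with
   <A, X> = <A, X0> = 0, so X A = 0 and f vanishes on the whole feasible set; and -(subdifferential
   of f) is {T}, so a dual certificate would put T into S. *)

theory Submission
  imports Defs
begin

lemma sym_mats_inner_commute:
  fixes M :: "real^'n^'n"
  assumes "M \<in> sym_mats"
  shows "u \<bullet> (M *v v) = v \<bullet> (M *v u)"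
  using assms by (metis (mono_tags, lifting) dot_lmul_matrix inner_commute
      mem_Collect_eq sym_mats_def vector_transpose_matrix)

lemma psd_scaleR:
  fixes M :: "real^'n^'n"
  assumes "psd M" "0 \<le> c"
  shows "psd (c *\<^sub>R M)"
  using assms
  by (auto simp: psd_def sym_mats_def transpose_scalar scaleR_matrix_vector_assoc[symmetric])

lemma outer_mult_vec: "outer x y *v v = (y \<bullet> v) *\<^sub>R x"
  by (simp add: vec_eq_iff outer_def matrix_vector_mult_def inner_vec_def sum_distrib_right
      sum_distrib_left mult_ac)

lemma transpose_outer: "transpose (outer x y) = outer y x"
  by (simp add: vec_eq_iff outer_def transpose_def mult.commute)

lemma inner_outer:
  fixes X :: "real^'n^'n"
  shows "outer x y \<bullet> X = x \<bullet> (X *v y)"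
  by (simp add: outer_def matrix_vector_mult_def inner_vec_def sum_distrib_left mult_ac)

lemma psd_outer: "psd (outer x x)"
  by (simp add: psd_def sym_mats_def transpose_outer outer_mult_vec inner_commute)

lemma sym_tensor_sym_mats: "sym_tensor x y \<in> sym_mats"
  by (simp add: sym_mats_def sym_tensor_def vec_eq_iff transpose_def outer_def mult.commute)

text \<open>The two rank-one terms contribute equally because \<open>X\<close> is symmetric. In this
  form the pairing vanishes as soon as \<open>q\<close> lies in the kernel of
  \<open>X\<close>.\<close>

lemma inner_sym_tensor:
  fixes X :: "real^'n^'n"
  assumes "X \<in> sym_mats"
  shows "sym_tensor y q \<bullet> X = 2 * (y \<bullet> (X *v q))"
  using sym_mats_inner_commute[OF assms, of q y]
  by (simp add: sym_tensor_def inner_add_left inner_outer)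

lemma subspace_sym_mats: "subspace (sym_mats :: (real^'n^'n) set)"
  by (simp add: subspace_def sym_mats_def vec_eq_iff transpose_def)

text \<open>The form of \<open>M\<close> at \<open>v + t *\<^sub>R u\<close> is a quadratic in
  \<open>t\<close> that is never negative, so its discriminant is not positive. \<open>M\<close> may
  be singular, so the leading coefficient can vanish.\<close>

lemma psd_Cauchy_Schwarz:
  fixes M :: "real^'n^'n"
  assumes "psd M"
  shows "(v \<bullet> (M *v u))\<^sup>2 \<le> (v \<bullet> (M *v v)) * (u \<bullet> (M *v u))"
proof -
  define a b c where "a = v \<bullet> (M *v v)" and "b = v \<bullet> (M *v u)" and "c = u \<bullet> (M *v u)"
  have quad: "0 \<le> a + 2 * t * b + t\<^sup>2 * c" for t
  proof -
    have "0 \<le> (v + t *\<^sub>R u) \<bullet> (M *v (v + t *\<^sub>R u))"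
      using assms by (simp add: psd_def)
    also have "\<dots> = a + 2 * t * b + t\<^sup>2 * c"
      using sym_mats_inner_commute[of M u v] assms
      by (simp add: psd_def a_def b_def c_def matrix_vector_right_distrib inner_add_left
          inner_add_right matrix_vector_mult_scaleR power2_eq_square algebra_simps)
    finally show ?thesis .
  qed
  have "0 \<le> c" using assms by (simp add: psd_def c_def)
  have "b\<^sup>2 \<le> a * c"
  proof (cases "c = 0")
    case True
    have "b = 0"
    proof (rule ccontr)
      assume "b \<noteq> 0"
      \<comment> \<open>The polynomial is now affine in \<open>t\<close>, and this \<open>t\<close>
        gives it the value -1.\<close>
      then show False using quad[of "- (a + 1) / (2 * b)"] True by (simp add: field_simps)
    qed
    then show ?thesis using True by simp
  next
    case False
    with \<open>0 \<le> c\<close> have "0 < c" by simp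
    \<comment> \<open>The quadratic is evaluated at its minimizer.\<close>
    then have "a + 2 * (- b / c) * b + (- b / c)\<^sup>2 * c = (a * c - b\<^sup>2) / c"
      by (simp add: field_simps power2_eq_square)
    then show ?thesis using quad[of "- b / c"] \<open>0 < c\<close> by (simp add: zero_le_divide_iff)
  qed
  then show ?thesis by (simp add: a_def b_def c_def)
qed

text \<open>Cauchy-Schwarz with \<open>v = M *v u\<close> bounds the fourth power of the norm of
  \<open>M *v u\<close> by zero.\<close>

lemma psd_kernel:
  fixes M :: "real^'n^'n"
  assumes "psd M" "u \<bullet> (M *v u) = 0"
  shows "M *v u = 0"
  using psd_Cauchy_Schwarz[OF assms(1), of "M *v u" u] assms(2) by simp

text \<open>Nonnegativity of this form at \<open>v\<close> is Cauchy-Schwarz for \<open>v\<close>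
  and \<open>p\<close>. It is a symmetric elimination step multiplied by its pivot, so a zero pivot
  is harmless.\<close>

lemma psd_deflate:
  fixes M :: "real^'n^'n"
  assumes "psd M"
  shows "psd ((p \<bullet> (M *v p)) *\<^sub>R M - outer (M *v p) (M *v p))"
proof -
  have "(v \<bullet> (M *v p)) * (v \<bullet> (M *v p)) \<le> (p \<bullet> (M *v p)) * (v \<bullet> (M *v v))" for v
    using psd_Cauchy_Schwarz[OF assms, of v p] by (simp add: power2_eq_square mult.commute)
  moreover have "(p \<bullet> (M *v p)) *\<^sub>R M - outer (M *v p) (M *v p) \<in> sym_mats"
    using psd_scaleR[OF assms, of "p \<bullet> (M *v p)"] psd_outer[of "M *v p"] assms
    by (intro subspace_diff[OF subspace_sym_mats]) (simp_all add: psd_def)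
  ultimately show ?thesis
    by (simp add: psd_def matrix_vector_mult_diff_rdistrib outer_mult_vec inner_diff_right
        scaleR_matrix_vector_assoc[symmetric] inner_commute)
qed

text \<open>Deflating along the \<open>i\<close>-th axis annihilates the \<open>i\<close>-th diagonal entry and preserves the
  vanishing ones, so induction on the number of nonzero diagonal entries replaces the spectral
  theorem.\<close>

lemma psd_inner_nonneg:
  fixes M X :: "real^'n^'n"
  assumes "psd M" "psd X"
  shows "0 \<le> M \<bullet> X"
  using assms(1)
proof (induction "card {i. M$i$i \<noteq> 0}" arbitrary: M rule: less_induct)
  case less
  have diag: "axis j 1 \<bullet> (N *v axis j 1) = N$j$j" for j and N :: "real^'n^'n"
    by (simp add: matrix_vector_mul_component inner_axis' inner_axis)
  show ?case
  proof (cases "\<exists>i. M$i$i \<noteq> 0")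
    case False
    \<comment> \<open>Every axis is isotropic for \<open>M\<close>, hence in its kernel, so all
      columns vanish.\<close>
    then have "M *v axis j 1 = 0" for j
      using psd_kernel[OF less.prems, of "axis j 1"] diag[of j M] by simp
    then have "M = 0"
      by (simp add: vec_eq_iff matrix_vector_mul_component inner_axis)
    then show ?thesis by simp
  next
    case True
    then obtain i where i: "M$i$i \<noteq> 0" by blast
    define a where "a = M *v axis i 1"
    define N where "N = (M$i$i) *\<^sub>R M - outer a a"
    have N: "psd N"
      using psd_deflate[OF less.prems, of "axis i 1"] by (simp add: N_def a_def diag)
    have "0 < M$i$i"
      using less.prems i diag[of i M] by (metis order_le_less psd_def)
    have Njj: "N$j$j = M$i$i * M$j$j - a$j * a$j" for j
      by (simp add: N_def outer_def)
    \<comment> \<open>Here \<open>N$j$j\<close> is minus a square, yet \<open>N\<close> is positive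
      semidefinite.\<close>
    have "N$j$j = 0" if "M$j$j = 0" for j
    proof -
      have "0 \<le> N$j$j" using N diag[of j N] by (metis psd_def)
      then show ?thesis using Njj[of j] that zero_le_square[of "a$j"] by simp
    qed
    moreover have "N$i$i = 0"
      by (simp add: Njj a_def matrix_vector_mul_component inner_axis)
    ultimately have "{j. N$j$j \<noteq> 0} \<subset> {j. M$j$j \<noteq> 0}"
      using i by blast
    then have "0 \<le> N \<bullet> X"
      by (intro less.hyps N psubset_card_mono) simp_all
    moreover have "0 \<le> outer a a \<bullet> X"
      using assms(2) by (simp add: inner_outer psd_def)
    \<comment> \<open>The pivot times \<open>M\<close> is \<open>N + outer a a\<close>, and both
      summands pair nonnegatively with \<open>X\<close>.\<close>
    ultimately have "0 \<le> M$i$i * (M \<bullet> X)"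
      by (simp add: N_def inner_diff_left)
    then show ?thesis using \<open>0 < M$i$i\<close> by (simp add: zero_le_mult_iff)
  qed
qed

text \<open>The deflation of \<open>M\<close> along \<open>p\<close> pairs nonnegatively with
  \<open>X\<close>. As \<open>M\<close> itself pairs to zero, only minus the form of
  \<open>X\<close> at \<open>M *v p\<close> remains, so that form vanishes and
  \<open>psd_kernel\<close> applies to \<open>X\<close>.\<close>

lemma psd_orthogonal_mult:
  fixes M X :: "real^'n^'n"
  assumes "psd M" "psd X" "M \<bullet> X = 0"
  shows "X *v (M *v p) = 0"
proof (rule psd_kernel[OF assms(2)])
  have "0 \<le> ((p \<bullet> (M *v p)) *\<^sub>R M - outer (M *v p) (M *v p)) \<bullet> X"
    using psd_inner_nonneg psd_deflate assms by blast
  then have "(M *v p) \<bullet> (X *v (M *v p)) \<le> 0"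
    by (simp add: inner_diff_left assms(3) inner_outer)
  then show "(M *v p) \<bullet> (X *v (M *v p)) = 0"
    using assms(2) by (metis order_antisym psd_def)
qed

lemma meas_adj_inner: "meas_adj A l \<bullet> X = l \<bullet> meas A X"
  by (simp add: meas_adj_def meas_def inner_sum_left inner_vec_def[of l] inner_commute[of X])

text \<open>Moving from \<open>X\<close> in the direction \<open>G - T\<close>, which is symmetric
  since subgradients are, turns the subgradient inequality into a nonpositive squared norm of
  \<open>G - T\<close>.\<close>

lemma subdifferential_linear:
  fixes T :: "real^'n^'n"
  assumes "G \<in> subdifferential (\<lambda>X. T \<bullet> X) X" "T \<in> sym_mats" "X \<in> sym_mats"
  shows "G = T"
proof -
  have "X + (G - T) \<in> sym_mats"
    using assms by (intro subspace_add[OF subspace_sym_mats] subspace_diff[OF subspace_sym_mats]) (auto simp: subdifferential_def)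
  then have "T \<bullet> X + G \<bullet> (X + (G - T) - X) \<le> T \<bullet> (X + (G - T))"
    using assms(1) unfolding subdifferential_def by blast
  then have "(G - T) \<bullet> (G - T) \<le> 0"
    by (simp add: inner_add_right inner_diff_left)
  then show ?thesis
    by (metis inner_ge_zero inner_eq_zero_iff order_antisym right_minus_eq)
qed

theorem theorem5:
  fixes x0 :: "real^'n" and X0 :: "real^'n^'n" and A :: "'m::finite \<Rightarrow> real^'n^'n"
  assumes "X0 = outer x0 x0"
    and "\<And>i. A i \<in> sym_mats"
    and "\<not> completeness A x0"
  shows "\<exists>f :: real^'n^'n \<Rightarrow> real.
           convex_on sym_mats f \<and> continuous_on sym_mats f \<and>
           is_arg_min f (feasible A (meas A X0)) X0 \<and>
           \<not> (\<exists>l Q. dual_certificate A f X0 l Q)"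
proof -
  obtain l y p where psdB: "psd (meas_adj A l)" and orth: "orthogonal (meas_adj A l) X0"
    and notS: "sym_tensor y (meas_adj A l *v p) \<notin> S_set A X0"
    using assms(3) unfolding completeness_def assms(1) by blast
  define T where "T = sym_tensor y (meas_adj A l *v p)"
  define f where "f = (\<lambda>X. (- T) \<bullet> X)"
  have T: "- T \<in> sym_mats"
    using subspace_neg[OF subspace_sym_mats sym_tensor_sym_mats] by (simp add: T_def)
  have X0: "psd X0" by (simp add: assms(1) psd_outer)
  have zero: "f X = 0" if "feasible A (meas A X0) X" for X
  proof -
    have X: "psd X" "meas A X = meas A X0" using that by (auto simp: feasible_def)
    \<comment> \<open>By adjointness this pairing depends on \<open>X\<close> only through
      \<open>meas A X\<close>, so it equals the one at \<open>X0\<close>.\<close>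
    then have "meas_adj A l \<bullet> X = 0"
      using orth by (simp add: meas_adj_inner orthogonal_def)
    then show ?thesis
      using psd_orthogonal_mult[OF psdB X(1), of p] X(1)
      by (simp add: f_def T_def inner_sym_tensor psd_def)
  qed
  have "convex_on sym_mats f"
    unfolding f_def
    by (intro convex_onI subspace_imp_convex subspace_sym_mats) (simp add: inner_add_right)
  moreover have "continuous_on sym_mats f"
    unfolding f_def by (intro continuous_intros)
  \<comment> \<open>\<open>X0\<close> is feasible and \<open>f\<close> is constant on the feasible
    set.\<close>
  moreover have "is_arg_min f (feasible A (meas A X0)) X0"
    using X0 zero by (auto simp: is_arg_min_def feasible_def)
  moreover have False if cert: "dual_certificate A f X0 l' Q" for l' Q
  proof -
    obtain G where G: "G \<in> subdifferential f X0" "meas_adj A l' + Q = - G"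
      and Q: "nsd Q" "orthogonal Q X0"
      using cert by (auto simp: dual_certificate_def)
    have "G = - T"
      using subdifferential_linear[OF G(1)[unfolded f_def] T] X0 by (simp add: psd_def)
    then have "T = meas_adj A l' + Q" using G(2) by simp
    then show False using notS Q unfolding S_set_def T_def[symmetric] by blast
  qed
  ultimately show ?thesis by blast
qed

end
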